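(* Let $X$ be a real Banach space that admits an equivalent norm whose dual norm is locally uniformly convex on $X^*$. Then every convex body in $X$ can be approximated, with respect to the Hausdorff metric, by Fréchet smooth convex bodies: for every convex body $B\subset X$ and every $\varepsilon>0$ there is a Fréchet smooth convex body $C\subset X$ with $d_H(B,C)<\varepsilon$.
   Context: A convex body in a real Banach space $X$ is a closed bounded convex set with nonempty interior. For convex bodies $A,B$, $d_H(A,B)=\inf\{r>0: A\subset \overline{B+rB_X},\ B\subset\overline{A+rB_X}\}$, where $B_X$ is the closed unit ball of $X$. For a closed convex set $C$ with $0\in\operatorname{int}C$, its Minkowski functional is $p_C(x)=\inf\{\lambda>0: x\in\lambda C\}$. A convex body $B$ with $0\in\operatorname{int}(B)$ is Fréchet smooth if $p_B$ is Fréchet differentiable at every nonzero point of $X$; a general convex body $B$ is Fréchet smooth if there is $x_0\in\operatorname{int}(B)$ such that $B-x_0$ is Fréchet smooth in this sense. A norm $\|\cdot\|$ is locally uniformly convex if for every $x$ with $\|x\|=1$ and every sequence $\{x_n\}$ with $\|x_n\|=1$ and $\|x+x_n\|\to2$ one has $x_n\to x$. *)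

theory Defs
  imports "HOL-Analysis.Analysis"
begin

definition convex_body :: "'a::real_normed_vector set \<Rightarrow> bool" where
  "convex_body B \<longleftrightarrow> closed B \<and> bounded B \<and> convex B \<and> interior B \<noteq> {}"

definition hausdorff_dist :: "'a::real_normed_vector set \<Rightarrow> 'a set \<Rightarrow> real" where
  "hausdorff_dist A B = Inf {r. r > 0 \<and>
     A \<subseteq> closure {b + r *\<^sub>R u | b u. b \<in> B \<and> u \<in> cball 0 1} \<and>
     B \<subseteq> closure {a + r *\<^sub>R u | a u. a \<in> A \<and> u \<in> cball 0 1}}"

definition minkowski_functional :: "'a::real_vector set \<Rightarrow> 'a \<Rightarrow> real" where
  "minkowski_functional C x = Inf {t. t > 0 \<and> x \<in> (\<lambda>c. t *\<^sub>R c) ` C}"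

text \<open>On a normed space, \<^const>\<open>differentiable\<close> asks for a bounded linear derivative,
  that is, it is Frechet differentiability.\<close>

definition frechet_smooth_at_origin :: "'a::real_normed_vector set \<Rightarrow> bool" where
  "frechet_smooth_at_origin B \<longleftrightarrow> convex_body B \<and> 0 \<in> interior B \<and>
     (\<forall>x. x \<noteq> 0 \<longrightarrow> minkowski_functional B differentiable (at x))"

definition frechet_smooth :: "'a::real_normed_vector set \<Rightarrow> bool" where
  "frechet_smooth B \<longleftrightarrow> convex_body B \<and>
     (\<exists>x0 \<in> interior B. frechet_smooth_at_origin ((\<lambda>b. b - x0) ` B))"

definition is_norm :: "('a::real_vector \<Rightarrow> real) \<Rightarrow> bool" where
  "is_norm N \<longleftrightarrow> (\<forall>x. N x = 0 \<longleftrightarrow> x = 0) \<and>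
     (\<forall>c x. N (c *\<^sub>R x) = \<bar>c\<bar> * N x) \<and> (\<forall>x y. N (x + y) \<le> N x + N y)"

definition equivalent_norm :: "('a::real_normed_vector \<Rightarrow> real) \<Rightarrow> bool" where
  "equivalent_norm N \<longleftrightarrow> is_norm N \<and>
     (\<exists>a>0. \<exists>b>0. \<forall>x. a * norm x \<le> N x \<and> N x \<le> b * norm x)"

text \<open>For an equivalent norm \<open>N\<close>, the functionals continuous with respect to \<open>N\<close> are exactly
  those continuous with respect to \<^const>\<open>norm\<close>, so the bounded linear functions into the reals
  form the dual space for both norms.\<close>

definition dual_norm :: "('a::real_normed_vector \<Rightarrow> real) \<Rightarrow> ('a \<Rightarrow>\<^sub>L real) \<Rightarrow> real" where
  "dual_norm N f = Sup {\<bar>blinfun_apply f x\<bar> | x. N x \<le> 1}"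

text \<open>Convergence is convergence in the norm \<open>N\<close> under consideration.\<close>

definition locally_uniformly_convex :: "('a::real_vector \<Rightarrow> real) \<Rightarrow> bool" where
  "locally_uniformly_convex N \<longleftrightarrow>
     (\<forall>x. \<forall>xs :: nat \<Rightarrow> 'a. N x = 1 \<longrightarrow> (\<forall>n. N (xs n) = 1) \<longrightarrow>
        (\<lambda>n. N (x + xs n)) \<longlonglongrightarrow> 2 \<longrightarrow> (\<lambda>n. N (xs n - x)) \<longlonglongrightarrow> 0)"

end

theory Submission
  imports Defs
begin

text \<open>Translate so that \<open>0\<close> is interior to \<open>B\<close>, let \<open>p\<close> be the Minkowski functional of \<open>B\<close> and
  let \<open>q(x) = inf\<^sub>y sqrt (p(y)\<^sup>2 + (k N(x - y))\<^sup>2)\<close> with \<open>k\<close> large. Then \<open>q \<le> p \<le> (1 + \<theta>) q\<close> with \<open>\<theta>\<close>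
  small, so \<open>{q \<le> 1}\<close> is Hausdorff close to \<open>B\<close>. The polar of \<open>{q \<le> 1}\<close> has the gauge
  \<open>S(f) = sqrt (H(f)\<^sup>2 + (N*(f) / k)\<^sup>2)\<close>, where \<open>H\<close> is the support function of \<open>B\<close> and \<open>N*\<close> the dual
  norm. If \<open>f\<close> supports \<open>q\<close> at \<open>x\<close>, \<open>f\<^sub>i\<close> supports \<open>q\<close> at \<open>z\<^sub>i\<close>, and \<open>z\<^sub>i\<close> tends to \<open>x\<close>, then
  \<open>S(f + f\<^sub>i)\<close> tends to \<open>2\<close>; as both summands of \<open>S\<^sup>2\<close> are convex, this forces \<open>N*(f\<^sub>i)\<close> to tend to
  \<open>N*(f)\<close> and \<open>N*(f + f\<^sub>i)\<close> to \<open>2 N*(f)\<close>, and local uniform convexity yields norm convergence of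
  \<open>f\<^sub>i\<close> to \<open>f\<close>. Norm continuity of supporting functionals is Frechet differentiability of \<open>q\<close>. The
  dual argument is needed because the infimum defining \<open>q\<close> need not be attained.\<close>

section \<open>Sublinear functions and the Hahn-Banach theorem\<close>

text \<open>Homogeneous for nonnegative scalars only: a convex body need not be symmetric, so its
  gauge need not be even.\<close>

definition sublinear :: "('a::real_vector \<Rightarrow> real) \<Rightarrow> bool" where
  "sublinear q \<longleftrightarrow> (\<forall>x y. q (x + y) \<le> q x + q y) \<and> (\<forall>c x. c \<ge> 0 \<longrightarrow> q (c *\<^sub>R x) = c * q x)"

lemma sublinear_add: "sublinear q \<Longrightarrow> q (x + y) \<le> q x + q y"
  and sublinear_scale: "sublinear q \<Longrightarrow> c \<ge> 0 \<Longrightarrow> q (c *\<^sub>R x) = c * q x"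
  by (auto simp: sublinear_def)

lemma sublinear_0: "sublinear q \<Longrightarrow> q 0 = 0"
  using sublinear_scale[of q 0 0] by simp

lemma sublinear_diff_le: "sublinear q \<Longrightarrow> q x - q y \<le> q (x - y)"
  using sublinear_add[of q "x - y" y] by simp

lemma sublinear_minus_ge: "sublinear q \<Longrightarrow> - q (- x) \<le> q x"
  using sublinear_add[of q x "- x"] sublinear_0[of q] by simp

text \<open>Applying \<open>le\<close> to \<open>inverse c\<close> and \<open>c *\<^sub>R x\<close>
  gives the opposite inequality. The one-sided form suits the functions below, all of them
  infima.\<close>

lemma sublinearI_scale_le:
  assumes "\<And>x y. q (x + y) \<le> q x + q y" "q 0 = 0"
    and le: "\<And>c x. c > 0 \<Longrightarrow> q (c *\<^sub>R x) \<le> c * q x"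
  shows "sublinear q"
proof -
  have "q (c *\<^sub>R x) = c * q x" if "c \<ge> 0" for c x
  proof (cases "c = 0")
    case False
    then have "q (inverse c *\<^sub>R (c *\<^sub>R x)) \<le> inverse c * q (c *\<^sub>R x)"
      using that by (intro le) auto
    then have "q x \<le> q (c *\<^sub>R x) / c"
      using False by (simp add: divide_simps)
    then have "c * q x \<le> q (c *\<^sub>R x)"
      using False that by (simp add: pos_le_divide_eq mult.commute)
    then show ?thesis
      using le[of c x] that False by simp
  qed (simp add: assms)
  with assms(1) show ?thesis
    by (auto simp: sublinear_def)
qed

text \<open>The Hahn-Banach descent step: \<open>q\<close> is lowered until it is linear along
  \<open>x\<close>. In the infimum \<open>r\<close>, \<open>t = 0\<close> gives
  \<open>r \<le> q\<close>, and \<open>t = 1\<close> at \<open>- x\<close> gives the last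
  claim.\<close>

lemma sublinear_descent:
  assumes q: "sublinear q"
  obtains r where "sublinear r" "\<And>z. r z \<le> q z" "r (- x) \<le> - q x"
proof -
  define r where "r z = (INF t\<in>{0..}. q (z + t *\<^sub>R x) - t * q x)" for z
  \<comment> \<open>Subadditivity for \<open>t *\<^sub>R x = (z + t *\<^sub>R x) + (- z)\<close>; it
    makes the real infimum in \<open>r\<close> meaningful.\<close>
  have lb: "- q (- z) \<le> q (z + t *\<^sub>R x) - t * q x" if "t \<ge> 0" for z t
    using sublinear_add[OF q, of "z + t *\<^sub>R x" "- z"] sublinear_scale[OF q that, of x] by simp
  have bdd: "bdd_below ((\<lambda>t. q (z + t *\<^sub>R x) - t * q x) ` {0..})" for z
    using lb by (intro bdd_belowI2[where m = "- q (- z)"]) auto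
  have le: "r z \<le> q (z + t *\<^sub>R x) - t * q x" if "t \<ge> 0" for z t
    unfolding r_def using that by (intro cINF_lower[OF bdd]) auto
  have ge: "m \<le> r z" if "\<And>t. t \<ge> 0 \<Longrightarrow> m \<le> q (z + t *\<^sub>R x) - t * q x" for m z
    unfolding r_def using that by (intro cINF_greatest) auto
  have "sublinear r"
  proof (rule sublinearI_scale_le)
    fix y z
    \<comment> \<open>One infimum at a time: with \<open>t\<close> fixed, the shifts
      \<open>s\<close> for \<open>y\<close> and \<open>t\<close> for \<open>z\<close> add up to the
      shift \<open>s + t\<close> for \<open>y + z\<close>; afterwards \<open>t\<close>
      varies.\<close>
    have "r (y + z) - (q (z + t *\<^sub>R x) - t * q x) \<le> r y" if "t \<ge> 0" for t
    proof (rule ge)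
      fix s :: real assume "s \<ge> 0"
      have "r (y + z) \<le> q ((y + s *\<^sub>R x) + (z + t *\<^sub>R x)) - (s + t) * q x"
        using le[of "s + t" "y + z"] \<open>s \<ge> 0\<close> that by (simp add: algebra_simps)
      also have "\<dots> \<le> q (y + s *\<^sub>R x) + q (z + t *\<^sub>R x) - (s + t) * q x"
        using sublinear_add[OF q] by (simp add: diff_right_mono)
      finally show "r (y + z) - (q (z + t *\<^sub>R x) - t * q x) \<le> q (y + s *\<^sub>R x) - s * q x"
        by (simp add: algebra_simps)
    qed
    then have "r (y + z) - r y \<le> r z"
      by (intro ge) (simp add: algebra_simps)
    then show "r (y + z) \<le> r y + r z" by simp
  next
    show "r 0 = 0"
      using le[of 0 0] ge[of 0 0] q by (auto simp: sublinear_0 sublinear_scale intro: antisym)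
  next
    fix c :: real and z assume c: "c > 0"
    have "inverse c * r (c *\<^sub>R z) \<le> r z"
    proof (rule ge)
      fix t :: real assume t: "t \<ge> 0"
      have "r (c *\<^sub>R z) \<le> q (c *\<^sub>R (z + t *\<^sub>R x)) - (c * t) * q x"
        using le[of "c * t" "c *\<^sub>R z"] c t by (simp add: algebra_simps)
      also have "\<dots> = c * (q (z + t *\<^sub>R x) - t * q x)"
        using c by (simp add: sublinear_scale[OF q] right_diff_distrib)
      finally show "inverse c * r (c *\<^sub>R z) \<le> q (z + t *\<^sub>R x) - t * q x"
        using c by (simp add: field_simps)
    qed
    then show "r (c *\<^sub>R z) \<le> c * r z"
      using c by (simp add: field_simps)
  qed
  moreover have "r z \<le> q z" for z
    using le[of 0 z] by simp
  moreover have "r (- x) \<le> - q x"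
    using le[of 1 "- x"] q by (simp add: sublinear_0)
  ultimately show ?thesis using that by blast
qed

text \<open>Supplies the bounds of chains for Zorn's lemma. The estimate
  \<open>k z \<ge> - k (- z) \<ge> - q (- z)\<close> keeps the infimum finite.\<close>

lemma sublinear_Inf_chain:
  fixes K :: "('a::real_vector \<Rightarrow> real) set"
  assumes "K \<noteq> {}" and K: "\<And>k. k \<in> K \<Longrightarrow> sublinear k" "\<And>k z. k \<in> K \<Longrightarrow> k z \<le> q z"
    and chain: "\<And>k l. k \<in> K \<Longrightarrow> l \<in> K \<Longrightarrow> k \<le> l \<or> l \<le> k"
  shows "sublinear (\<lambda>z. INF k\<in>K. k z)" "\<And>k z. k \<in> K \<Longrightarrow> (INF k\<in>K. k z) \<le> k z"
proof -
  let ?r = "\<lambda>z. INF k\<in>K. k z"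
  have bdd: "bdd_below ((\<lambda>k. k z) ` K)" for z
  proof (rule bdd_belowI2[where m = "- q (- z)"])
    fix k assume "k \<in> K"
    then show "- q (- z) \<le> k z"
      using sublinear_minus_ge[OF K(1), of k z] K(2)[of k "- z"] by simp
  qed
  show le: "?r z \<le> k z" if "k \<in> K" for k z
    by (rule cINF_lower[OF bdd that])
  have ge: "m \<le> ?r z" if "\<And>k. k \<in> K \<Longrightarrow> m \<le> k z" for m z
    using \<open>K \<noteq> {}\<close> that by (intro cINF_greatest)
  show "sublinear ?r"
  proof (rule sublinearI_scale_le)
    fix y z
    have "?r (y + z) - l z \<le> ?r y" if "l \<in> K" for l
    proof (rule ge)
      fix k assume "k \<in> K"
      \<comment> \<open>The smaller of \<open>k\<close> and \<open>l\<close> serves both arguments;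
        this is how the chain condition yields subadditivity.\<close>
      obtain j where j: "j \<in> K" "j \<le> k" "j \<le> l"
        using chain[OF \<open>k \<in> K\<close> \<open>l \<in> K\<close>] \<open>k \<in> K\<close> \<open>l \<in> K\<close> by blast
      have "?r (y + z) \<le> j y + j z"
        using le[OF j(1)] sublinear_add[OF K(1)[OF j(1)]] order_trans by blast
      then show "?r (y + z) - l z \<le> k y"
        using le_funD[OF j(2), of y] le_funD[OF j(3), of z] by simp
    qed
    then have "?r (y + z) - ?r y \<le> ?r z"
      by (intro ge) (simp add: algebra_simps)
    then show "?r (y + z) \<le> ?r y + ?r z" by simp
  next
    show "?r 0 = 0"
      using \<open>K \<noteq> {}\<close> K(1) by (simp add: sublinear_0)
  next
    fix c :: real and z assume c: "c > 0"
    have "inverse c * ?r (c *\<^sub>R z) \<le> ?r z"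
    proof (rule ge)
      fix k assume "k \<in> K"
      then have "?r (c *\<^sub>R z) \<le> c * k z"
        using le[of k "c *\<^sub>R z"] sublinear_scale[OF K(1), of k c z] c by simp
      then show "inverse c * ?r (c *\<^sub>R z) \<le> k z"
        using c by (simp add: field_simps)
    qed
    then show "?r (c *\<^sub>R z) \<le> c * ?r z"
      using c by (simp add: field_simps)
  qed
qed

text \<open>A minimal sublinear function is odd, hence linear, because \<open>sublinear_descent\<close> cannot lower
  it any further. Starting from a function below \<^term>\<open>q\<close> with value at most \<^term>\<open>- q x\<close> at
  \<^term>\<open>- x\<close> forces equality at \<^term>\<open>x\<close>.\<close>

theorem Hahn_Banach_sublinear:
  fixes q :: "'a::real_vector \<Rightarrow> real"
  assumes q: "sublinear q"
  obtains f where "linear f" "\<And>z. f z \<le> q z" "f x = q x"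
proof -
  obtain r where r: "sublinear r" "\<And>z. r z \<le> q z" "r (- x) \<le> - q x"
    using sublinear_descent[OF q] by blast
  define A where "A = {k. sublinear k \<and> (\<forall>z. k z \<le> r z)}"
  \<comment> \<open>\<open>predicate_Zorn\<close> yields maximal elements; the reversed order turns
    them into minimal ones.\<close>
  let ?R = "relation_of (\<ge>) A"
  have po: "partial_order_on A ?R"
    by (rule partial_order_on_relation_ofI) auto
  have "\<exists>u\<in>A. \<forall>k\<in>K. u \<le> k" if "K \<in> Chains ?R" for K
  proof (cases "K = {}")
    case True
    with r(1) show ?thesis by (auto simp: A_def)
  next
    case False
    have K: "K \<subseteq> A" "\<And>k l. k \<in> K \<Longrightarrow> l \<in> K \<Longrightarrow> k \<le> l \<or> l \<le> k"
      using that by (auto simp: Chains_def relation_of_def)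
    have KA: "sublinear k" "k z \<le> r z" if "k \<in> K" for k z
      using K(1) that by (auto simp: A_def)
    have u: "sublinear (\<lambda>z. INF k\<in>K. k z)"
      by (rule sublinear_Inf_chain(1)[where q = r]) (use False KA K(2) in auto)
    have u2: "(INF k\<in>K. k z) \<le> k z" if "k \<in> K" for k z
      by (rule sublinear_Inf_chain(2)[where q = r and K = K and k = k and z = z])
        (use that False KA K(2) in auto)
    have "(\<lambda>z. INF k\<in>K. k z) \<in> A"
      using u u2 False KA(2) unfolding A_def by (blast intro: order_trans)
    then show ?thesis
      using u2 by (intro bexI[of _ "\<lambda>z. INF k\<in>K. k z"]) (auto simp: le_fun_def)
  qed
  from predicate_Zorn[OF po this] obtain m where m: "m \<in> A" "\<And>k. k \<in> A \<Longrightarrow> k \<le> m \<Longrightarrow> k = m"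
    by blast
  have sm: "sublinear m" and mr: "\<And>z. m z \<le> r z"
    using m(1) by (auto simp: A_def)
  have odd: "m (- y) = - m y" for y
  proof -
    obtain k where k: "sublinear k" "\<And>z. k z \<le> m z" "k (- y) \<le> - m y"
      using sublinear_descent[OF sm] by blast
    then have "k = m"
      using m mr by (intro m(2)) (auto simp: A_def le_fun_def intro: order_trans)
    with k(3) sublinear_minus_ge[OF sm, of "- y"] show ?thesis by simp
  qed
  have "m (y + z) = m y + m z" for y z
    using sublinear_add[OF sm, of y z] sublinear_add[OF sm, of "y + z" "- z"] odd[of z] by simp
  moreover have "m (c *\<^sub>R y) = c * m y" for c y
  proof (cases "c \<ge> 0")
    case False
    then have "m ((- c) *\<^sub>R y) = (- c) * m y" by (intro sublinear_scale[OF sm]) simp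
    then show ?thesis using odd[of "c *\<^sub>R y"] by simp
  qed (rule sublinear_scale[OF sm])
  ultimately have "linear m"
    by (intro linearI) auto
  moreover have "m z \<le> q z" for z
    using mr r(2) order_trans by blast
  moreover have "m x = q x"
    using odd[of x] mr[of "- x"] r(3) \<open>m x \<le> q x\<close> by simp
  ultimately show ?thesis using that by blast
qed

text \<open>Evaluating \<open>f \<le> q\<close> at \<open>z\<close> and \<open>- z\<close> bounds
  \<open>\<bar>f z\<bar>\<close> by a multiple of the norm, whence continuity.\<close>

corollary Hahn_Banach_blinfun:
  fixes q :: "'a::real_normed_vector \<Rightarrow> real"
  assumes q: "sublinear q" and b: "\<And>z. q z \<le> b * norm z"
  obtains f :: "'a \<Rightarrow>\<^sub>L real" where "\<And>z. blinfun_apply f z \<le> q z" "blinfun_apply f x = q x"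
proof -
  obtain f where f: "linear f" "\<And>z. f z \<le> q z" "f x = q x"
    using Hahn_Banach_sublinear[OF q] by blast
  have "\<bar>f z\<bar> \<le> norm z * b" for z
    using f(2)[of z] f(2)[of "- z"] b[of z] b[of "- z"] linear_neg[OF f(1), of z]
    by (auto simp: abs_le_iff mult.commute)
  then have "bounded_linear f"
    using f(1) by (intro bounded_linear_intro[of f b]) (auto simp: linear_add linear_scale)
  then show ?thesis
    using f by (intro that[of "Blinfun f"]) (simp_all add: bounded_linear_Blinfun_apply)
qed

section \<open>Minkowski functionals\<close>

lemma minkowski_functional_eq:
  "minkowski_functional C x = Inf {t. t > 0 \<and> x /\<^sub>R t \<in> C}"
proof -
  have "x \<in> (\<lambda>c. t *\<^sub>R c) ` C \<longleftrightarrow> x /\<^sub>R t \<in> C" if "t > 0" for t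
    using that by (auto simp: image_iff intro!: bexI[of _ "x /\<^sub>R t"])
  then show ?thesis
    unfolding minkowski_functional_def by (metis (lifting))
qed

lemma minkowski_functional_le:
  assumes "t > 0" "x /\<^sub>R t \<in> C"
  shows "minkowski_functional C x \<le> t"
  unfolding minkowski_functional_eq using assms
  by (intro cInf_lower bdd_belowI[of _ 0]) auto

lemma le_minkowski_functional:
  assumes "t > 0" "x /\<^sub>R t \<in> C" and "\<And>t. t > 0 \<Longrightarrow> x /\<^sub>R t \<in> C \<Longrightarrow> m \<le> t"
  shows "m \<le> minkowski_functional C x"
  unfolding minkowski_functional_eq using assms
  by (intro cInf_greatest) auto

text \<open>Turns the differentiability demanded by \<open>frechet_smooth_at_origin\<close> into a
  statement about \<open>q\<close> itself.\<close>

lemma minkowski_functional_gauge: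
  assumes q: "sublinear q" and q0: "\<And>x. q x \<ge> 0"
  shows "minkowski_functional {x. q x \<le> 1} = q"
proof
  fix x
  have iff: "x /\<^sub>R t \<in> {x. q x \<le> 1} \<longleftrightarrow> q x \<le> t" if "t > 0" for t
    using that by (simp add: sublinear_scale[OF q] divide_inverse[symmetric] mult.commute[of "inverse t"])
  show "minkowski_functional {x. q x \<le> 1} x = q x"
  proof (rule antisym)
    \<comment> \<open>Admissible \<open>t\<close> are positive while \<open>q x\<close> may vanish,
      so \<open>q x + e\<close> is tested.\<close>
    show "minkowski_functional {x. q x \<le> 1} x \<le> q x"
    proof (rule field_le_epsilon)
      fix e :: real assume "e > 0"
      then show "minkowski_functional {x. q x \<le> 1} x \<le> q x + e"
        using q0[of x] iff[of "q x + e"] by (intro minkowski_functional_le) auto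
    qed
    show "q x \<le> minkowski_functional {x. q x \<le> 1} x"
      using q0[of x] iff by (intro le_minkowski_functional[of "q x + 1"]) auto
  qed
qed

text \<open>A ball inside \<open>B\<close> bounds the functional from above, a ball around
  \<open>B\<close> bounds it from below, and closedness recovers \<open>B\<close> as the unit
  ball.\<close>

lemma
  assumes B: "convex_body B" and 0: "0 \<in> interior B"
  shows sublinear_minkowski_functional: "sublinear (minkowski_functional B)"
    and minkowski_functional_bounds: "\<exists>\<alpha>>0. \<exists>\<beta>>0. \<forall>x.
      \<alpha> * norm x \<le> minkowski_functional B x \<and> minkowski_functional B x \<le> \<beta> * norm x"
    and minkowski_functional_unit_ball: "{x. minkowski_functional B x \<le> 1} = B"
proof -
  let ?p = "minkowski_functional B"
  have cl: "closed B" and cv: "convex B"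
    using B by (auto simp: convex_body_def)
  obtain R where R: "R > 0" "\<And>x. x \<in> B \<Longrightarrow> norm x \<le> R"
    using B by (auto simp: convex_body_def bounded_pos)
  obtain \<rho> where \<rho>: "\<rho> > 0" "cball 0 \<rho> \<subseteq> B"
    using 0 mem_interior_cball by blast
  have "0 \<in> B" using 0 interior_subset by blast
  have absorb: "x /\<^sub>R t \<in> B" if "t > 0" "norm x \<le> t * \<rho>" for x t
    using \<rho>(2) that by (auto simp: field_simps subset_iff)
  have ub: "?p x \<le> norm x / \<rho>" for x
  proof (cases "x = 0")
    case True
    have "?p 0 \<le> 0 + e" if "e > 0" for e
      using minkowski_functional_le[of e 0 B] that \<open>0 \<in> B\<close> by simp
    then show ?thesis
      using True field_le_epsilon[of "?p 0" 0] by simp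
  next
    case False
    then show ?thesis
      using \<rho>(1) by (intro minkowski_functional_le absorb) auto
  qed
  have ex: "\<exists>t>0. x /\<^sub>R t \<in> B" for x
  proof (intro exI conjI)
    \<comment> \<open>The summand \<open>1\<close> keeps the scale positive at
      \<open>x = 0\<close>.\<close>
    show pos: "norm x / \<rho> + 1 > 0"
      using \<rho>(1) by (simp add: add_nonneg_pos)
    show "x /\<^sub>R (norm x / \<rho> + 1) \<in> B"
      using \<rho>(1) by (intro absorb pos) (simp add: distrib_right)
  qed
  have ge: "m \<le> ?p x" if "\<And>t. t > 0 \<Longrightarrow> x /\<^sub>R t \<in> B \<Longrightarrow> m \<le> t" for m x
    using le_minkowski_functional ex that by metis
  have lb: "norm x / R \<le> ?p x" for x
  proof (rule ge)
    fix t :: real assume "t > 0" "x /\<^sub>R t \<in> B"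
    then show "norm x / R \<le> t"
      using R(2)[of "x /\<^sub>R t"] R(1) by (simp add: field_simps)
  qed
  show "\<exists>\<alpha>>0. \<exists>\<beta>>0. \<forall>x. \<alpha> * norm x \<le> ?p x \<and> ?p x \<le> \<beta> * norm x"
    using lb ub R(1) \<rho>(1) by (intro exI[of _ "1 / R"] exI[of _ "1 / \<rho>"] conjI) auto
  have mem: "x /\<^sub>R t \<in> B" if less: "?p x < t" for x t
  proof -
    obtain s where s: "s > 0" "x /\<^sub>R s \<in> B" "s < t"
      using ge[of x t] less by (meson not_le)
    \<comment> \<open>\<open>x /\<^sub>R t\<close> lies on the segment from \<open>0\<close> to
      \<open>x /\<^sub>R s\<close>.\<close>
    have "(s / t) *\<^sub>R (x /\<^sub>R s) + (1 - s / t) *\<^sub>R 0 \<in> B"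
      using s by (intro convexD[OF cv] \<open>0 \<in> B\<close>) (auto simp: field_simps)
    then show ?thesis using s by (simp add: field_simps)
  qed
  show "sublinear ?p"
  proof (rule sublinearI_scale_le)
    fix x y
    have "?p (x + y) - t \<le> ?p x" if t: "t > 0" "y /\<^sub>R t \<in> B" for t
    proof (rule ge)
      fix s :: real assume s: "s > 0" "x /\<^sub>R s \<in> B"
      have "(s / (s + t)) *\<^sub>R (x /\<^sub>R s) + (t / (s + t)) *\<^sub>R (y /\<^sub>R t) \<in> B"
        using s t by (intro convexD[OF cv]) (auto simp: add_divide_distrib[symmetric])
      then have "(x + y) /\<^sub>R (s + t) \<in> B"
        using s t by (simp add: field_simps scaleR_add_right)
      then show "?p (x + y) - t \<le> s"
        using minkowski_functional_le[of "s + t" "x + y" B] s t by simp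
    qed
    then have "?p (x + y) - ?p x \<le> ?p y"
      by (intro ge) (simp add: algebra_simps)
    then show "?p (x + y) \<le> ?p x + ?p y" by simp
  next
    show "?p 0 = 0" using ub[of 0] lb[of 0] by simp
  next
    fix c :: real and x assume c: "c > 0"
    have "?p (c *\<^sub>R x) / c \<le> ?p x"
    proof (rule ge)
      fix t :: real assume "t > 0" "x /\<^sub>R t \<in> B"
      then show "?p (c *\<^sub>R x) / c \<le> t"
        using minkowski_functional_le[of "c * t" "c *\<^sub>R x" B] c by (simp add: field_simps)
    qed
    then show "?p (c *\<^sub>R x) \<le> c * ?p x" using c by (simp add: field_simps)
  qed
  show "{x. ?p x \<le> 1} = B"
  proof safe
    fix x assume "?p x \<le> 1"
    \<comment> \<open>\<open>mem\<close> asks for a strict inequality, so \<open>x\<close> is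
      reached as a limit of slightly shrunken points of \<open>B\<close>.\<close>
    then have "x /\<^sub>R (1 + 1 / real (Suc n)) \<in> B" for n
      by (intro mem) (rule le_less_trans[of _ 1], simp_all)
    moreover have "(\<lambda>n. x /\<^sub>R (1 + 1 / real (Suc n))) \<longlonglongrightarrow> x /\<^sub>R (1 + 0)"
      by (intro tendsto_intros LIMSEQ_Suc[OF lim_1_over_n]) auto
    ultimately show "x \<in> B"
      using closed_sequentially[OF cl, of "\<lambda>n. x /\<^sub>R (1 + 1 / real (Suc n))"] by simp
  next
    fix x assume "x \<in> B"
    then show "?p x \<le> 1"
      using minkowski_functional_le[of 1 x B] by simp
  qed
qed

section \<open>Unit balls of gauges comparable to the norm\<close>

lemma continuous_on_sublinear:
  fixes q :: "'a::real_normed_vector \<Rightarrow> real"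
  assumes q: "sublinear q" and ub: "\<And>x. q x \<le> b * norm x"
  shows "continuous_on S q"
proof (rule continuous_on_subset[OF lipschitz_on_continuous_on])
  show "\<bar>b\<bar>-lipschitz_on (UNIV :: 'a set) q"
  proof (rule lipschitz_onI)
    fix x y :: 'a
    have "q x - q y \<le> \<bar>b\<bar> * norm (x - y)" for x y :: 'a
      using sublinear_diff_le[OF q, of x y] ub[of "x - y"] abs_ge_self[of b]
        mult_right_mono[of b "\<bar>b\<bar>" "norm (x - y)"] by simp
    from this[of x y] this[of y x] show "dist (q x) (q y) \<le> \<bar>b\<bar> * dist x y"
      by (simp add: dist_norm norm_minus_commute abs_le_iff)
  qed simp
qed simp

lemma convex_body_gauge:
  fixes q :: "'a::real_normed_vector \<Rightarrow> real"
  assumes q: "sublinear q" and a: "a > 0" "\<And>x. a * norm x \<le> q x"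
    and b: "b > 0" "\<And>x. q x \<le> b * norm x"
  shows "convex_body {x. q x \<le> 1}" "0 \<in> interior {x. q x \<le> 1}"
proof -
  have cont: "continuous_on UNIV q"
    using q b(2) by (rule continuous_on_sublinear)
  have "ball (0 :: 'a) (1 / b) \<subseteq> {x. q x \<le> 1}"
  proof
    fix x :: 'a assume "x \<in> ball 0 (1 / b)"
    then have "b * norm x \<le> 1"
      using b(1) by (simp add: field_simps)
    then show "x \<in> {x. q x \<le> 1}"
      using b(2)[of x] by simp
  qed
  then show int: "0 \<in> interior {x. q x \<le> 1}"
    using b(1) by (intro interiorI[of "ball (0 :: 'a) (1 / b)"]) auto
  have "convex {x. q x \<le> 1}"
  proof (rule convexI)
    fix x y and u v :: real
    assume *: "x \<in> {x. q x \<le> 1}" "y \<in> {x. q x \<le> 1}" "u \<ge> 0" "v \<ge> 0" "u + v = 1"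
    have "q (u *\<^sub>R x + v *\<^sub>R y) \<le> u * q x + v * q y"
      using sublinear_add[OF q] sublinear_scale[OF q] * by metis
    also have "\<dots> \<le> u * 1 + v * 1"
      using * by (intro add_mono mult_left_mono) auto
    finally show "u *\<^sub>R x + v *\<^sub>R y \<in> {x. q x \<le> 1}" using * by simp
  qed
  moreover have "bounded {x. q x \<le> 1}"
  proof (rule boundedI)
    fix x assume "x \<in> {x. q x \<le> 1}"
    then show "norm x \<le> 1 / a"
      using a(1) a(2)[of x] by (simp add: field_simps)
  qed
  moreover have "closed {x. q x \<le> 1}"
    using cont by (intro closed_Collect_le) auto
  ultimately show "convex_body {x. q x \<le> 1}"
    using int by (auto simp: convex_body_def)
qed

section \<open>Dual norms and local uniform convexity\<close>

lemma is_normD: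
  assumes "is_norm N"
  shows "N x = 0 \<longleftrightarrow> x = 0" "N (c *\<^sub>R x) = \<bar>c\<bar> * N x" "N (x + y) \<le> N x + N y" "N x \<ge> 0"
proof -
  show eq: "N x = 0 \<longleftrightarrow> x = 0" "N (c *\<^sub>R x) = \<bar>c\<bar> * N x" "N (x + y) \<le> N x + N y" for x y c
    using assms by (auto simp: is_norm_def)
  show "N x \<ge> 0"
    using eq(3)[of x "(-1) *\<^sub>R x"] eq(1)[of 0] eq(2)[of "-1" x] by simp
qed

lemma is_norm_minus: "is_norm N \<Longrightarrow> N (- x) = N x"
  using is_normD(2)[of N "-1" x] by simp

text \<open>Comparability with \<open>norm\<close> keeps the supremum in \<open>dual_norm\<close>
  finite. The bound on \<open>norm f\<close> later turns convergence in the dual norm into operator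
  norm convergence.\<close>

lemma
  fixes N :: "'a::real_normed_vector \<Rightarrow> real"
  assumes N: "equivalent_norm N"
  shows blinfun_le_dual_norm: "blinfun_apply f x \<le> dual_norm N f * N x"
    and dual_norm_le: "(\<And>x. N x \<le> 1 \<Longrightarrow> blinfun_apply f x \<le> m) \<Longrightarrow> dual_norm N f \<le> m"
    and norm_le_dual_norm: "\<exists>b. \<forall>f. norm f \<le> b * dual_norm N f"
    and is_norm_dual_norm: "is_norm (dual_norm N)"
proof -
  have norm_N: "is_norm N" using N by (simp add: equivalent_norm_def)
  note [simp] = is_normD(1,2,4)[OF norm_N]
  have [simp]: "N 0 = 0" by simp
  obtain a b where ab: "a > 0" "b > 0" "\<And>x. a * norm x \<le> N x" "\<And>x. N x \<le> b * norm x"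
    using N by (auto simp: equivalent_norm_def)
  have bdd: "bdd_above {\<bar>blinfun_apply f x\<bar> | x. N x \<le> 1}" for f :: "'a \<Rightarrow>\<^sub>L real"
  proof (rule bdd_aboveI, clarify)
    fix x assume "N x \<le> 1"
    then have "norm x \<le> 1 / a"
      using ab(1) ab(3)[of x] by (simp add: field_simps)
    then have "norm f * norm x \<le> norm f * (1 / a)"
      by (intro mult_left_mono) auto
    then show "\<bar>blinfun_apply f x\<bar> \<le> norm f * (1 / a)"
      using norm_blinfun[of f x] by simp
  qed
  have le: "\<bar>blinfun_apply f x\<bar> \<le> dual_norm N f" if "N x \<le> 1" for f x
    unfolding dual_norm_def using that by (intro cSup_upper bdd) auto
  have "{\<bar>blinfun_apply f x\<bar> | x. N x \<le> 1} \<noteq> {}" for f :: "'a \<Rightarrow>\<^sub>L real"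
    by (auto intro!: exI[of _ 0])
  then have ge_abs: "dual_norm N f \<le> m" if "\<And>x. N x \<le> 1 \<Longrightarrow> \<bar>blinfun_apply f x\<bar> \<le> m" for f m
    unfolding dual_norm_def using that by (intro cSup_least) auto
  show ge: "dual_norm N f \<le> m" if m: "\<And>x. N x \<le> 1 \<Longrightarrow> blinfun_apply f x \<le> m" for f m
  proof (rule ge_abs)
    fix x assume "N x \<le> 1"
    then show "\<bar>blinfun_apply f x\<bar> \<le> m"
      using m[of x] m[of "- x"] is_norm_minus[OF norm_N, of x]
      by (simp add: blinfun.minus_right abs_le_iff)
  qed
  have le_mult: "\<bar>blinfun_apply f x\<bar> \<le> dual_norm N f * N x" for f x
  proof (cases "x = 0")
    case False
    then have "N x > 0" using is_normD(1,4)[OF norm_N, of x] by linarith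
    then show ?thesis
      using le[of "x /\<^sub>R N x" f] by (simp add: blinfun.scaleR_right abs_mult field_simps)
  qed simp
  then show "blinfun_apply f x \<le> dual_norm N f * N x" for f x
    using abs_ge_self order_trans by blast
  have pos: "dual_norm N f \<ge> 0" for f
    using le[of 0 f] by simp
  have "norm f \<le> b * dual_norm N f" for f
  proof (rule norm_blinfun_bound)
    show "b * dual_norm N f \<ge> 0" using ab pos by simp
    fix x
    have "dual_norm N f * N x \<le> dual_norm N f * (b * norm x)"
      using ab pos by (intro mult_left_mono) auto
    then show "norm (blinfun_apply f x) \<le> b * dual_norm N f * norm x"
      using le_mult[of f x] by (simp add: mult_ac)
  qed
  then show nle: "\<exists>b. \<forall>f. norm f \<le> b * dual_norm N f" by blast
  show "is_norm (dual_norm N)"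
    unfolding is_norm_def
  proof (intro conjI allI)
    fix f g :: "'a \<Rightarrow>\<^sub>L real" and c :: real
    have scale: "dual_norm N (c *\<^sub>R f) \<le> \<bar>c\<bar> * dual_norm N f" for c f
      using le by (intro ge_abs) (auto simp: blinfun.scaleR_left abs_mult intro: mult_left_mono)
    have "dual_norm N 0 = 0"
      using ge_abs[of 0 0] pos[of 0] by simp
    moreover have "f = 0" if "dual_norm N f = 0"
      using nle that by (metis mult_zero_right norm_le_zero_iff)
    ultimately show "dual_norm N f = 0 \<longleftrightarrow> f = 0" by blast
    show "dual_norm N (c *\<^sub>R f) = \<bar>c\<bar> * dual_norm N f"
    proof (cases "c = 0")
      case False
      have "\<bar>c\<bar> * dual_norm N (inverse c *\<^sub>R c *\<^sub>R f) \<le> \<bar>c\<bar> * (\<bar>inverse c\<bar> * dual_norm N (c *\<^sub>R f))"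
        by (intro mult_left_mono scale) simp
      then show ?thesis
        using False scale[of c f] by (simp add: abs_mult[symmetric] mult.assoc[symmetric])
    qed (simp add: \<open>dual_norm N 0 = 0\<close>)
    show "dual_norm N (f + g) \<le> dual_norm N f + dual_norm N g"
      using le by (intro ge_abs) (smt (verit) blinfun.add_left)
  qed
qed

text \<open>The definition speaks of unit vectors; normalising extends it to sequences whose norms
  merely converge to that of the limit.\<close>

lemma locally_uniformly_convex_tendsto:
  fixes xs :: "nat \<Rightarrow> 'a::real_vector"
  assumes M: "is_norm M" and luc: "locally_uniformly_convex M"
    and lim: "(\<lambda>n. M (xs n)) \<longlonglongrightarrow> M x" and lim2: "(\<lambda>n. M (x + xs n)) \<longlonglongrightarrow> 2 * M x"
  shows "(\<lambda>n. M (xs n - x)) \<longlonglongrightarrow> 0"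
proof (cases "x = 0")
  case True
  then show ?thesis using lim is_normD(1)[OF M, of 0] by simp
next
  case False
  note [simp] = is_normD(1,2,4)[OF M]
  have [simp]: "M 0 = 0" by simp
  define m where "m = M x"
  have m: "m > 0" using False is_normD(1,4)[OF M, of x] unfolding m_def by linarith
  have lim: "(\<lambda>n. M (xs n)) \<longlonglongrightarrow> m" and lim2: "(\<lambda>n. M (x + xs n)) \<longlonglongrightarrow> 2 * m"
    using lim lim2 by (simp_all add: m_def)
  have diff: "\<bar>M u - M v\<bar> \<le> M (u - v)" for u v
    using is_normD(3)[OF M, of "u - v" v] is_normD(3)[OF M, of "v - u" u] is_norm_minus[OF M, of "u - v"]
    by simp
  define y where "y = x /\<^sub>R m"
  \<comment> \<open>The default \<open>y\<close> keeps every \<open>ys n\<close> on the unit sphere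
    and preserves \<open>M (xs n) *\<^sub>R ys n = xs n\<close> when
    \<open>xs n = 0\<close>.\<close>
  define ys where "ys n = (if xs n = 0 then y else xs n /\<^sub>R M (xs n))" for n
  have My: "M y = 1" using m by (simp add: y_def flip: m_def)
  have Mys: "M (ys n) = 1" for n
    using My is_normD(1,4)[OF M, of "xs n"] by (simp add: ys_def)
  have xs: "M (xs n) *\<^sub>R ys n = xs n" for n
    by (auto simp: ys_def)
  \<comment> \<open>Replacing \<open>ys n\<close> by \<open>xs n /\<^sub>R m\<close> costs only the
    relative error of the lengths.\<close>
  have "(\<lambda>n. M (y + ys n) - M (x + xs n) / m) \<longlonglongrightarrow> 0"
  proof (rule Lim_null_comparison)
    show "(\<lambda>n. \<bar>1 - M (xs n) / m\<bar>) \<longlonglongrightarrow> 0"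
      using tendsto_rabs[OF tendsto_diff[OF tendsto_const[of 1] tendsto_divide[OF lim tendsto_const[of m]]]] m
      by simp
    have "\<bar>M (y + ys n) - M (x + xs n) / m\<bar> \<le> \<bar>1 - M (xs n) / m\<bar>" for n
    proof -
      have "M (x + xs n) / m = M ((x + xs n) /\<^sub>R m)" using m by (simp add: divide_inverse)
      then have "\<bar>M (y + ys n) - M (x + xs n) / m\<bar> \<le> M ((y + ys n) - (x + xs n) /\<^sub>R m)"
        using diff[of "y + ys n" "(x + xs n) /\<^sub>R m"] by simp
      also have "(y + ys n) - (x + xs n) /\<^sub>R m = ys n - (M (xs n) *\<^sub>R ys n) /\<^sub>R m"
        unfolding xs by (simp add: y_def algebra_simps)
      also have "\<dots> = (1 - M (xs n) / m) *\<^sub>R ys n"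
        by (simp add: algebra_simps divide_inverse)
      finally show ?thesis using Mys by simp
    qed
    then show "\<forall>\<^sub>F n in sequentially. norm (M (y + ys n) - M (x + xs n) / m) \<le> \<bar>1 - M (xs n) / m\<bar>"
      by simp
  qed
  from tendsto_add[OF this tendsto_divide[OF lim2 tendsto_const[of m]]]
  have "(\<lambda>n. M (y + ys n)) \<longlonglongrightarrow> 2" using m by simp
  with luc My Mys have lim3: "(\<lambda>n. M (ys n - y)) \<longlonglongrightarrow> 0"
    unfolding locally_uniformly_convex_def by blast
  show ?thesis
  proof (rule Lim_null_comparison)
    show "(\<lambda>n. M (xs n) * M (ys n - y) + \<bar>M (xs n) - m\<bar>) \<longlonglongrightarrow> 0"
      using tendsto_add[OF tendsto_mult[OF lim lim3] tendsto_rabs[OF tendsto_diff[OF lim tendsto_const[of m]]]]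
      by simp
    have "M (xs n - x) \<le> M (xs n) * M (ys n - y) + \<bar>M (xs n) - m\<bar>" for n
    proof -
      \<comment> \<open>An error of direction plus an error of length.\<close>
      have "xs n - x = M (xs n) *\<^sub>R (ys n - y) + (M (xs n) - m) *\<^sub>R y"
        using m by (simp add: xs algebra_simps y_def)
      then show ?thesis
        using is_normD(3)[OF M, of "M (xs n) *\<^sub>R (ys n - y)" "(M (xs n) - m) *\<^sub>R y"] My by simp
    qed
    then show "\<forall>\<^sub>F n in sequentially. norm (M (xs n - x)) \<le> M (xs n) * M (ys n - y) + \<bar>M (xs n) - m\<bar>"
      by simp
  qed
qed

section \<open>Infimal convolution in the \<open>\<ell>\<^sub>2\<close> sense\<close>

text \<open>The gauge of the polar of the unit ball of \<open>p\<close>. Unlike in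
  \<open>dual_norm\<close> there is no absolute value, since this ball may be asymmetric.\<close>

definition support_function :: "('a::real_normed_vector \<Rightarrow> real) \<Rightarrow> ('a \<Rightarrow>\<^sub>L real) \<Rightarrow> real" where
  "support_function p f = (SUP x\<in>{x. p x \<le> 1}. blinfun_apply f x)"

lemma
  fixes p :: "'a::real_normed_vector \<Rightarrow> real"
  assumes p: "sublinear p" and a: "a > 0" "\<And>x. a * norm x \<le> p x"
  shows blinfun_le_support_function: "blinfun_apply f x \<le> support_function p f * p x"
    and support_function_le: "(\<And>x. p x \<le> 1 \<Longrightarrow> blinfun_apply f x \<le> m) \<Longrightarrow> support_function p f \<le> m"
    and support_function_nonneg: "support_function p f \<ge> 0"
proof -
  have bdd: "bdd_above (blinfun_apply f ` {x. p x \<le> 1})"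
  proof (rule bdd_aboveI2)
    fix x assume "x \<in> {x. p x \<le> 1}"
    then have "norm x \<le> 1 / a"
      using a(1) a(2)[of x] by (simp add: field_simps)
    then have "norm f * norm x \<le> norm f * (1 / a)"
      by (intro mult_left_mono) auto
    then show "blinfun_apply f x \<le> norm f * (1 / a)"
      using norm_blinfun[of f x] by simp
  qed
  have le: "blinfun_apply f x \<le> support_function p f" if "p x \<le> 1" for x
    unfolding support_function_def using that by (intro cSUP_upper bdd) auto
  show "support_function p f \<ge> 0"
    using le[of 0] sublinear_0[OF p] by simp
  show "blinfun_apply f x \<le> support_function p f * p x"
  proof (cases "x = 0")
    case False
    then have "p x > 0"
      using a(1) a(2)[of x] by (smt (verit) mult_pos_pos zero_less_norm_iff)
    then show ?thesis
      using le[of "x /\<^sub>R p x"] by (simp add: sublinear_scale[OF p] blinfun.scaleR_right field_simps)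
  qed (simp add: sublinear_0[OF p])
  have "{x. p x \<le> 1} \<noteq> {}"
    using sublinear_0[OF p] by (metis empty_iff mem_Collect_eq zero_le_one)
  then show "support_function p f \<le> m" if "\<And>x. p x \<le> 1 \<Longrightarrow> blinfun_apply f x \<le> m"
    unfolding support_function_def using that by (intro cSUP_least) auto
qed

text \<open>The square root of the infimal convolution of the squares: positive homogeneity
  survives, and the dual gauge becomes an l2-sum.\<close>

definition l2_infconv :: "('a::real_vector \<Rightarrow> real) \<Rightarrow> ('a \<Rightarrow> real) \<Rightarrow> 'a \<Rightarrow> real" where
  "l2_infconv p n x = (INF y. sqrt ((p y)\<^sup>2 + (n (x - y))\<^sup>2))"

lemma l2_infconv_le: "l2_infconv p n x \<le> sqrt ((p y)\<^sup>2 + (n (x - y))\<^sup>2)"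
  unfolding l2_infconv_def by (intro cINF_lower bdd_belowI2[where m = 0]) auto

lemma le_l2_infconv:
  "(\<And>y. m \<le> sqrt ((p y)\<^sup>2 + (n (x - y))\<^sup>2)) \<Longrightarrow> m \<le> l2_infconv p n x"
  unfolding l2_infconv_def by (intro cINF_greatest) auto

text \<open>Adding competitors \<open>y\<close> and \<open>y'\<close> gives one for
  \<open>x + x'\<close>, and the triangle inequality in the Euclidean plane compares the
  roots.\<close>

lemma sublinear_l2_infconv:
  assumes p: "sublinear p" "\<And>x. p x \<ge> 0" and n: "sublinear n" "\<And>x. n x \<ge> 0"
  shows "sublinear (l2_infconv p n)"
proof (rule sublinearI_scale_le)
  fix x x'
  have "l2_infconv p n (x + x') - sqrt ((p y')\<^sup>2 + (n (x' - y'))\<^sup>2) \<le> l2_infconv p n x" for y'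
  proof (rule le_l2_infconv)
    fix y
    have "l2_infconv p n (x + x') \<le> sqrt ((p (y + y'))\<^sup>2 + (n ((x - y) + (x' - y')))\<^sup>2)"
      using l2_infconv_le[of p n "x + x'" "y + y'"] by (simp add: algebra_simps)
    also have "\<dots> \<le> sqrt ((p y + p y')\<^sup>2 + (n (x - y) + n (x' - y'))\<^sup>2)"
      using p n by (intro real_sqrt_le_mono add_mono power_mono sublinear_add) auto
    also have "\<dots> \<le> sqrt ((p y)\<^sup>2 + (n (x - y))\<^sup>2) + sqrt ((p y')\<^sup>2 + (n (x' - y'))\<^sup>2)"
      by (rule real_sqrt_sum_squares_triangle_ineq)
    finally show "l2_infconv p n (x + x') - sqrt ((p y')\<^sup>2 + (n (x' - y'))\<^sup>2)
        \<le> sqrt ((p y)\<^sup>2 + (n (x - y))\<^sup>2)" by simp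
  qed
  then have "l2_infconv p n (x + x') - l2_infconv p n x \<le> l2_infconv p n x'"
    by (intro le_l2_infconv) (simp add: algebra_simps)
  then show "l2_infconv p n (x + x') \<le> l2_infconv p n x + l2_infconv p n x'" by simp
next
  show "l2_infconv p n 0 = 0"
    using l2_infconv_le[of p n 0 0] le_l2_infconv[of 0 p n 0] p(1) n(1)
    by (auto simp: sublinear_0 intro: antisym)
next
  fix c :: real and x assume c: "c > 0"
  have "l2_infconv p n (c *\<^sub>R x) / c \<le> l2_infconv p n x"
  proof (rule le_l2_infconv)
    fix y
    have "l2_infconv p n (c *\<^sub>R x) \<le> sqrt ((p (c *\<^sub>R y))\<^sup>2 + (n (c *\<^sub>R (x - y)))\<^sup>2)"
      using l2_infconv_le[of p n "c *\<^sub>R x" "c *\<^sub>R y"] by (simp add: algebra_simps)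
    also have "\<dots> = sqrt (c\<^sup>2 * ((p y)\<^sup>2 + (n (x - y))\<^sup>2))"
      using c p n by (simp add: sublinear_scale power_mult_distrib distrib_left)
    also have "\<dots> = c * sqrt ((p y)\<^sup>2 + (n (x - y))\<^sup>2)"
      using c by (simp add: real_sqrt_mult)
    finally show "l2_infconv p n (c *\<^sub>R x) / c \<le> sqrt ((p y)\<^sup>2 + (n (x - y))\<^sup>2)"
      using c by (simp add: field_simps)
  qed
  then show "l2_infconv p n (c *\<^sub>R x) \<le> c * l2_infconv p n x"
    using c by (simp add: field_simps)
qed

lemma l2_infconv_le_left:
  assumes "sublinear n" "\<And>x. p x \<ge> 0"
  shows "l2_infconv p n x \<le> p x"
  using l2_infconv_le[of p n x x] assms by (simp add: sublinear_0)

text \<open>In \<open>p x \<le> p y + \<theta> * n (x - y)\<close> both \<open>p y\<close> and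
  \<open>n (x - y)\<close> are at most the root. A large \<open>n\<close> permits a small
  \<open>\<theta>\<close>, hence a close approximation.\<close>

lemma le_l2_infconv_mult:
  assumes p: "sublinear p" "\<And>x. p x \<ge> 0" and n: "\<And>x. n x \<ge> 0"
    and \<theta>: "\<theta> \<ge> 0" "\<And>x. p x \<le> \<theta> * n x"
  shows "p x \<le> (1 + \<theta>) * l2_infconv p n x"
proof -
  have "p x / (1 + \<theta>) \<le> l2_infconv p n x"
  proof (rule le_l2_infconv)
    fix y
    let ?s = "sqrt ((p y)\<^sup>2 + (n (x - y))\<^sup>2)"
    have "p x \<le> p y + \<theta> * n (x - y)"
      using sublinear_add[OF p(1), of y "x - y"] \<theta>(2)[of "x - y"] by simp
    also have "\<dots> \<le> ?s + \<theta> * ?s"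
      using \<theta>(1) by (intro add_mono mult_left_mono) auto
    finally show "p x / (1 + \<theta>) \<le> ?s"
      using \<theta>(1) by (simp add: field_simps)
  qed
  then show ?thesis using \<theta>(1) by (simp add: field_simps)
qed

text \<open>The gauge of the polar of the unit ball of \<^term>\<open>l2_infconv p (\<lambda>x. k * N x)\<close> is the
  \<open>\<ell>\<^sub>2\<close>-sum of the polar gauges; the next two lemmas are the two inequalities.\<close>

lemma support_function_l2_le:
  fixes p :: "'a::real_normed_vector \<Rightarrow> real"
  assumes p: "sublinear p" "a > 0" "\<And>x. a * norm x \<le> p x"
    and N: "equivalent_norm N" and k: "k > 0"
    and f: "\<And>x. blinfun_apply f x \<le> l2_infconv p (\<lambda>x. k * N x) x"
  shows "(support_function p f)\<^sup>2 + (dual_norm N f / k)\<^sup>2 \<le> 1"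
proof -
  have norm_N: "is_norm N" using N by (simp add: equivalent_norm_def)
  have p0: "p x \<ge> 0" for x
    using p(2) p(3)[of x] by (smt (verit) mult_nonneg_nonneg norm_ge_zero)
  define H where "H = support_function p f"
  define M where "M = dual_norm N f"
  have "H \<ge> 0"
    unfolding H_def using p by (rule support_function_nonneg)
  have "M \<ge> 0"
    unfolding M_def using is_norm_dual_norm[OF N] by (rule is_normD)
  \<comment> \<open>The competitor \<open>s *\<^sub>R y\<close> is used in the infimum at
    \<open>s *\<^sub>R y + t *\<^sub>R z\<close>.\<close>
  have yz: "s * blinfun_apply f y + t * blinfun_apply f z \<le> sqrt (s\<^sup>2 + (k * t)\<^sup>2)"
    if "s \<ge> 0" "t \<ge> 0" "p y \<le> 1" "N z \<le> 1" for s t y z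
  proof -
    have "s * blinfun_apply f y + t * blinfun_apply f z = blinfun_apply f (s *\<^sub>R y + t *\<^sub>R z)"
      by (simp add: blinfun.add_right blinfun.scaleR_right)
    also have "\<dots> \<le> sqrt ((p (s *\<^sub>R y))\<^sup>2 + (k * N (t *\<^sub>R z))\<^sup>2)"
      using f[of "s *\<^sub>R y + t *\<^sub>R z"] l2_infconv_le[of p "\<lambda>x. k * N x" "s *\<^sub>R y + t *\<^sub>R z" "s *\<^sub>R y"]
      by simp
    also have "\<dots> = sqrt ((s * p y)\<^sup>2 + (k * (t * N z))\<^sup>2)"
      using that by (simp add: sublinear_scale[OF p(1)] is_normD(2)[OF norm_N])
    also have "\<dots> \<le> sqrt ((s * 1)\<^sup>2 + (k * (t * 1))\<^sup>2)"
      using that k p0[of y] is_normD(4)[OF norm_N, of z]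
      by (intro real_sqrt_le_mono add_mono power_mono mult_left_mono mult_nonneg_nonneg) auto
    finally show ?thesis by simp
  qed
  \<comment> \<open>\<open>le_H\<close> and \<open>le_M\<close> pass to the suprema over
    \<open>y\<close> and \<open>z\<close> one after the other; a zero weight cannot be divided out
    and is treated apart.\<close>
  have le_H: "s * H \<le> m" if "s \<ge> 0" "\<And>y. p y \<le> 1 \<Longrightarrow> s * blinfun_apply f y \<le> m" for s m
  proof (cases "s = 0")
    case True
    then show ?thesis using that(2)[of 0] sublinear_0[OF p(1)] by simp
  next
    case False
    then have "H \<le> m / s"
      unfolding H_def using that by (intro support_function_le[OF p]) (auto simp: field_simps)
    then show ?thesis using False that(1) by (simp add: field_simps)
  qed
  have le_M: "t * M \<le> m" if "t \<ge> 0" "\<And>z. N z \<le> 1 \<Longrightarrow> t * blinfun_apply f z \<le> m" for t m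
  proof (cases "t = 0")
    case True
    then show ?thesis using that(2)[of 0] is_normD(1)[OF norm_N, of 0] by simp
  next
    case False
    then have "M \<le> m / t"
      unfolding M_def using that by (intro dual_norm_le[OF N]) (auto simp: field_simps)
    then show ?thesis using False that(1) by (simp add: field_simps)
  qed
  have HM: "s * H + t * M \<le> sqrt (s\<^sup>2 + (k * t)\<^sup>2)" if st: "s \<ge> 0" "t \<ge> 0" for s t
  proof -
    have "t * M \<le> sqrt (s\<^sup>2 + (k * t)\<^sup>2) - s * H"
    proof (rule le_M[OF st(2)])
      fix z assume "N z \<le> 1"
      then have "s * H \<le> sqrt (s\<^sup>2 + (k * t)\<^sup>2) - t * blinfun_apply f z"
        using yz[OF st] by (intro le_H[OF st(1)]) (simp add: algebra_simps)
      then show "t * blinfun_apply f z \<le> sqrt (s\<^sup>2 + (k * t)\<^sup>2) - s * H" by simp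
    qed
    then show ?thesis by simp
  qed
  define u where "u = H\<^sup>2 + (M / k)\<^sup>2"
  \<comment> \<open>The weights \<open>s = H\<close>, \<open>t = M / k^2\<close> are the extremal
    ones: the left side of \<open>HM\<close> becomes \<open>u\<close> and the right side
    \<open>sqrt u\<close>.\<close>
  have "u \<le> sqrt u"
    using HM[of H "M / k\<^sup>2"] \<open>H \<ge> 0\<close> \<open>M \<ge> 0\<close> k by (simp add: u_def power2_eq_square field_simps)
  moreover have "sqrt u < u" if "u > 1"
    using that real_sqrt_less_mono[of u "u\<^sup>2"] by (simp add: power2_eq_square)
  ultimately have "u \<le> 1" by (meson not_le)
  then show ?thesis by (simp add: u_def H_def M_def)
qed

lemma blinfun_le_l2_infconv:
  fixes p :: "'a::real_normed_vector \<Rightarrow> real"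
  assumes p: "sublinear p" "a > 0" "\<And>x. a * norm x \<le> p x"
    and N: "equivalent_norm N" and k: "k > 0"
  shows "blinfun_apply f x \<le>
    l2_infconv p (\<lambda>x. k * N x) x * sqrt ((support_function p f)\<^sup>2 + (dual_norm N f / k)\<^sup>2)"
proof -
  define H where "H = support_function p f"
  define M where "M = dual_norm N f / k"
  define S where "S = sqrt (H\<^sup>2 + M\<^sup>2)"
  have le: "blinfun_apply f x \<le> S * sqrt ((p y)\<^sup>2 + (k * N (x - y))\<^sup>2)" for y
  proof -
    have "blinfun_apply f x = blinfun_apply f y + blinfun_apply f (x - y)"
      by (simp add: blinfun.diff_right)
    also have "\<dots> \<le> H * p y + M * (k * N (x - y))"
      using blinfun_le_support_function[OF p, of f y] blinfun_le_dual_norm[OF N, of f "x - y"] k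
      by (simp add: H_def M_def)
    \<comment> \<open>Cauchy-Schwarz in the plane joins the two polar estimates.\<close>
    also have "\<dots> = inner (H, M) (p y, k * N (x - y))"
      by simp
    also have "\<dots> \<le> S * sqrt ((p y)\<^sup>2 + (k * N (x - y))\<^sup>2)"
      using norm_cauchy_schwarz[of "(H, M)" "(p y, k * N (x - y))"] by (simp add: norm_Pair S_def)
    finally show ?thesis .
  qed
  have "S \<ge> 0" by (simp add: S_def)
  have "blinfun_apply f x \<le> l2_infconv p (\<lambda>x. k * N x) x * S"
  proof (cases "S = 0")
    case True
    then show ?thesis using le by simp
  next
    case False
    then have "blinfun_apply f x / S \<le> l2_infconv p (\<lambda>x. k * N x) x"
      using le \<open>S \<ge> 0\<close> by (intro le_l2_infconv) (simp add: field_simps)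
    then show ?thesis using False \<open>S \<ge> 0\<close> by (simp add: field_simps)
  qed
  then show ?thesis by (simp add: S_def H_def M_def)
qed

text \<open>The heart of the smoothness proof. It treats arbitrary supports \<open>fs i\<close> at
  \<open>zs i\<close>, so any selection of supports is sequentially continuous where
  \<open>q\<close> is positive.\<close>

lemma l2_infconv_supports_tendsto:
  fixes p :: "'a::real_normed_vector \<Rightarrow> real"
  assumes p: "sublinear p" "a > 0" "\<And>x. a * norm x \<le> p x" "\<And>x. p x \<le> b * norm x"
    and N: "equivalent_norm N" "locally_uniformly_convex (dual_norm N)" and k: "k > 0"
    and q: "q = l2_infconv p (\<lambda>x. k * N x)" and x: "q x > 0"
    and f: "\<And>x. blinfun_apply f x \<le> q x" "blinfun_apply f x = q x"
    and fs: "\<And>i x. blinfun_apply (fs i) x \<le> q x" "\<And>i. blinfun_apply (fs i) (zs i) = q (zs i)"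
    and zs: "zs \<longlonglongrightarrow> x"
  shows "fs \<longlonglongrightarrow> f"
proof -
  have norm_N: "is_norm N" using N by (simp add: equivalent_norm_def)
  have p0: "p x \<ge> 0" for x
    using p(2) p(3)[of x] by (smt (verit) mult_nonneg_nonneg norm_ge_zero)
  have sn: "sublinear (\<lambda>x. k * N x)" "\<And>x. k * N x \<ge> 0"
    using k is_normD[OF norm_N] by (auto simp: sublinear_def distrib_left[symmetric])
  have sq: "sublinear q"
    unfolding q using p(1) p0 sn by (rule sublinear_l2_infconv)
  have "q z \<le> b * norm z" for z
    using l2_infconv_le_left[of "\<lambda>x. k * N x" p z] sn p0 p(4)[of z] q by simp
  then have cont: "continuous_on UNIV q"
    using sq by (rule continuous_on_sublinear[rotated])
  have q_tendsto: "(\<lambda>i. q (us i)) \<longlonglongrightarrow> q u" if "us \<longlonglongrightarrow> u" for us u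
    using continuous_on_tendsto_compose[OF cont that] by simp
  note norm_M = is_norm_dual_norm[OF N(1)]
  define H where "H = support_function p"
  \<comment> \<open>The dual norm of \<open>k * N\<close>.\<close>
  define n where "n g = dual_norm N g / k" for g :: "'a \<Rightarrow>\<^sub>L real"
  define S where "S g = sqrt ((H g)\<^sup>2 + (n g)\<^sup>2)" for g :: "'a \<Rightarrow>\<^sub>L real"
  have H0: "H g \<ge> 0" for g
    unfolding H_def using p(1-3) by (rule support_function_nonneg)
  have n0: "n g \<ge> 0" for g
    using k is_normD(4)[OF norm_M, of g] by (simp add: n_def)
  have H_add: "H (g + h) \<le> H g + H h" for g h
    unfolding H_def
  proof (rule support_function_le[OF p(1-3)])
    fix x assume "p x \<le> 1"
    then have "support_function p h * p x \<le> support_function p h * 1" for h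
      using H0[of h] by (intro mult_left_mono) (auto simp: H_def)
    then have "blinfun_apply h x \<le> support_function p h" for h
      using blinfun_le_support_function[OF p(1-3), of h x] by (smt (verit))
    then show "blinfun_apply (g + h) x \<le> support_function p g + support_function p h"
      by (simp add: blinfun.add_left add_mono)
  qed
  have n_add: "n (g + h) \<le> n g + n h" for g h
    using is_normD(3)[OF norm_M, of g h] k by (simp add: n_def add_divide_distrib[symmetric] divide_right_mono)
  have polar: "(H g)\<^sup>2 + (n g)\<^sup>2 \<le> 1" if "\<And>x. blinfun_apply g x \<le> q x" for g
    using support_function_l2_le[OF p(1-3) N(1) k] that by (simp add: H_def n_def q)
  \<comment> \<open>From \<open>2 (S f)^2 + 2 (S (fs i))^2 \<le> 4\<close>: the \<open>H\<close>
    part is estimated by convexity of the square, while for \<open>n\<close> the parallelogram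
    identity retains both convexity defects.\<close>
  have Sf: "S (f + fs i) ^ 2 + (n f - n (fs i))\<^sup>2 + ((n f + n (fs i))\<^sup>2 - (n (f + fs i))\<^sup>2) \<le> 4" for i
  proof -
    have "(H (f + fs i))\<^sup>2 \<le> (H f + H (fs i))\<^sup>2"
      by (rule power_mono[OF H_add H0])
    moreover have "(H f + H (fs i))\<^sup>2 \<le> 2 * (H f)\<^sup>2 + 2 * (H (fs i))\<^sup>2"
      using zero_le_power2[of "H f - H (fs i)"] unfolding power2_sum power2_diff by linarith
    ultimately show ?thesis
      using polar[OF f(1)] polar[OF fs(1), of i]
      by (simp add: S_def power2_sum power2_diff)
  qed
  have n_add2: "(n (f + fs i))\<^sup>2 \<le> (n f + n (fs i))\<^sup>2" for i
    by (rule power_mono[OF n_add n0])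
  have "(\<lambda>i. S (f + fs i)) \<longlonglongrightarrow> 2"
  proof (rule tendsto_sandwich)
    have S4: "S (f + fs i) ^ 2 \<le> 4" for i
      using Sf[of i] n_add2[of i] zero_le_power2[of "n f - n (fs i)"] by linarith
    have "S (f + fs i) \<le> 2" for i
      using S4[of i] power2_le_imp_le[of "S (f + fs i)" 2] by simp
    then show "\<forall>\<^sub>F i in sequentially. S (f + fs i) \<le> 2" by simp
    \<comment> \<open>Test \<open>f + fs i\<close> at \<open>x\<close>: as \<open>fs i\<close>
      supports \<open>q\<close> at \<open>zs i\<close>, its value at \<open>x\<close> is at least
      \<open>q (zs i) - q (zs i - x)\<close>.\<close>
    have "(q x + q (zs i) - q (zs i - x)) / q x \<le> S (f + fs i)" for i
    proof -
      have "q x + q (zs i) - q (zs i - x) \<le> blinfun_apply (f + fs i) x"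
        using f(2) fs(2)[of i] fs(1)[of i "zs i - x"]
        by (simp add: blinfun.add_left blinfun.diff_right)
      also have "\<dots> \<le> q x * S (f + fs i)"
        using blinfun_le_l2_infconv[OF p(1-3) N(1) k, of "f + fs i" x]
        by (simp add: q S_def H_def n_def)
      finally show ?thesis using x by (simp add: field_simps)
    qed
    then show "\<forall>\<^sub>F i in sequentially. (q x + q (zs i) - q (zs i - x)) / q x \<le> S (f + fs i)" by simp
    have "(\<lambda>i. zs i - x) \<longlonglongrightarrow> 0" using zs by (simp add: LIM_zero_iff)
    then have "(\<lambda>i. (q x + q (zs i) - q (zs i - x)) / q x) \<longlonglongrightarrow> (q x + q x - q 0) / q x"
      using x by (intro tendsto_intros q_tendsto zs) auto
    then show "(\<lambda>i. (q x + q (zs i) - q (zs i - x)) / q x) \<longlonglongrightarrow> 2"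
      using x by (simp add: sublinear_0[OF sq])
  qed simp
  then have "(\<lambda>i. 4 - S (f + fs i) ^ 2) \<longlonglongrightarrow> 4 - 2\<^sup>2"
    by (intro tendsto_intros)
  then have \<delta>: "(\<lambda>i. 4 - S (f + fs i) ^ 2) \<longlonglongrightarrow> 0" by simp
  \<comment> \<open>Each of the two nonnegative defects in \<open>Sf\<close> is at most
    \<open>4 - S^2\<close>, which tends to \<open>0\<close>.\<close>
  have "(\<lambda>i. (n f - n (fs i))\<^sup>2) \<longlonglongrightarrow> 0"
    by (rule Lim_null_comparison[OF always_eventually \<delta>]) (use Sf n_add2 in \<open>smt (verit) real_norm_def zero_le_power2\<close>)
  then have "(\<lambda>i. n f - n (fs i)) \<longlonglongrightarrow> 0"
    using tendsto_real_sqrt tendsto_rabs_zero_iff by fastforce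
  from tendsto_diff[OF tendsto_const[of "n f"] this] have n_lim: "(\<lambda>i. n (fs i)) \<longlonglongrightarrow> n f" by simp
  have "(\<lambda>i. (n f + n (fs i))\<^sup>2 - (n (f + fs i))\<^sup>2) \<longlonglongrightarrow> 0"
    by (rule Lim_null_comparison[OF always_eventually \<delta>]) (use Sf n_add2 in \<open>smt (verit) real_norm_def zero_le_power2\<close>)
  \<comment> \<open>Subtracting the second defect from \<open>(n f + n (fs i))^2\<close> isolates
    \<open>(n (f + fs i))^2\<close>.\<close>
  from tendsto_diff[OF tendsto_power[OF tendsto_add[OF tendsto_const[of "n f"] n_lim], of 2] this]
  have "(\<lambda>i. sqrt ((n (f + fs i))\<^sup>2)) \<longlonglongrightarrow> sqrt ((n f + n f)\<^sup>2)"
    by (intro tendsto_real_sqrt) simp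
  then have n_lim2: "(\<lambda>i. n (f + fs i)) \<longlonglongrightarrow> 2 * n f"
    unfolding real_sqrt_abs using n0 by simp
  have "(\<lambda>i. dual_norm N (fs i - f)) \<longlonglongrightarrow> 0"
  proof (rule locally_uniformly_convex_tendsto[OF norm_M N(2)])
    show "(\<lambda>i. dual_norm N (fs i)) \<longlonglongrightarrow> dual_norm N f"
      using tendsto_mult_left[OF n_lim, of k] k by (simp add: n_def)
    show "(\<lambda>i. dual_norm N (f + fs i)) \<longlonglongrightarrow> 2 * dual_norm N f"
      using tendsto_mult_left[OF n_lim2, of k] k by (simp add: n_def)
  qed
  moreover obtain c where c: "\<And>g :: 'a \<Rightarrow>\<^sub>L real. norm g \<le> c * dual_norm N g"
    using norm_le_dual_norm[OF N(1)] by blast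
  ultimately have "(\<lambda>i. c * dual_norm N (fs i - f)) \<longlonglongrightarrow> 0"
    using tendsto_mult_right_zero by blast
  then have "(\<lambda>i. fs i - f) \<longlonglongrightarrow> 0"
    by (rule Lim_null_comparison[rotated]) (simp add: c)
  then show ?thesis by (simp add: LIM_zero_iff)
qed

text \<open>At \<open>z\<close> the remainder of the linearisation by \<^term>\<open>F x\<close> is at most
  \<^term>\<open>blinfun_apply (F z - F x) (z - x)\<close>.\<close>

lemma has_derivative_of_continuous_supports:
  fixes q :: "'a::real_normed_vector \<Rightarrow> real" and F :: "'a \<Rightarrow> 'a \<Rightarrow>\<^sub>L real"
  assumes F: "\<And>z y. blinfun_apply (F z) y \<le> q y" "\<And>z. blinfun_apply (F z) z = q z"
    and cont: "isCont F x"
  shows "(q has_derivative blinfun_apply (F x)) (at x)"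
  unfolding has_derivative_iff_norm
proof
  show "bounded_linear (blinfun_apply (F x))" by (rule blinfun.bounded_linear_right)
  show "((\<lambda>y. norm (q y - q x - blinfun_apply (F x) (y - x)) / norm (y - x)) \<longlongrightarrow> 0) (at x)"
  proof (rule Lim_null_comparison)
    show "((\<lambda>y. norm (F y - F x)) \<longlongrightarrow> 0) (at x)"
      using cont by (simp add: isCont_def LIM_zero_iff tendsto_norm_zero_iff)
    have "\<bar>q y - q x - blinfun_apply (F x) (y - x)\<bar> \<le> norm (F y - F x) * norm (y - x)" for y
    proof -
      have "0 \<le> q y - q x - blinfun_apply (F x) (y - x)"
        using F(1)[of x y] F(2)[of x] by (simp add: blinfun.diff_right)
      moreover have "q y - q x - blinfun_apply (F x) (y - x) \<le> blinfun_apply (F y - F x) (y - x)"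
        using F(1)[of y x] F(2)[of y] by (simp add: blinfun.diff_right blinfun.diff_left)
      ultimately show ?thesis
        using norm_blinfun[of "F y - F x" "y - x"] by simp
    qed
    then show "\<forall>\<^sub>F y in at x. norm (norm (q y - q x - blinfun_apply (F x) (y - x)) / norm (y - x))
        \<le> norm (F y - F x)"
      by (intro always_eventually allI) (simp add: divide_le_eq)
  qed
qed

text \<open>Hahn-Banach provides a support at every point, and
  \<open>l2_infconv_supports_tendsto\<close> makes any such selection \<open>F\<close> continuous
  away from the origin.\<close>

lemma frechet_smooth_l2_infconv:
  fixes p :: "'a::real_normed_vector \<Rightarrow> real"
  assumes p: "sublinear p" "a > 0" "\<And>x. a * norm x \<le> p x" "b > 0" "\<And>x. p x \<le> b * norm x"
    and N: "equivalent_norm N" "locally_uniformly_convex (dual_norm N)" and k: "k > 0"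
    and \<theta>: "\<theta> > 0" "\<And>x. p x \<le> \<theta> * (k * N x)"
  shows "frechet_smooth_at_origin {x. l2_infconv p (\<lambda>x. k * N x) x \<le> 1}"
proof -
  define q where "q = l2_infconv p (\<lambda>x. k * N x)"
  have norm_N: "is_norm N" using N by (simp add: equivalent_norm_def)
  have p0: "p x \<ge> 0" for x
    using p(2) p(3)[of x] by (smt (verit) mult_nonneg_nonneg norm_ge_zero)
  have sn: "sublinear (\<lambda>x. k * N x)" "\<And>x. k * N x \<ge> 0"
    using k is_normD[OF norm_N] by (auto simp: sublinear_def distrib_left[symmetric])
  have sq: "sublinear q"
    unfolding q_def using p(1) p0 sn by (rule sublinear_l2_infconv)
  have ub: "q x \<le> b * norm x" for x
    using l2_infconv_le_left[of "\<lambda>x. k * N x" p x] sn p0 p(5)[of x] q_def by simp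
  \<comment> \<open>Coercivity passes from \<open>p\<close> to \<open>q\<close> through
    \<open>p \<le> (1 + \<theta>) q\<close>; it bounds the new body and makes \<open>q\<close>
    positive off \<open>0\<close>.\<close>
  have lb: "a / (1 + \<theta>) * norm x \<le> q x" for x
    using le_l2_infconv_mult[of p "\<lambda>x. k * N x" \<theta> x] p(1) p(3)[of x] p0 sn \<theta>
    by (simp add: field_simps q_def)
  have a': "a / (1 + \<theta>) > 0" using p(2) \<theta>(1) by simp
  have q0: "q x \<ge> 0" for x
    unfolding q_def by (rule le_l2_infconv) simp
  have "\<exists>f. (\<forall>y. blinfun_apply f y \<le> q y) \<and> blinfun_apply f z = q z" for z
    using Hahn_Banach_blinfun[OF sq ub, of z] by blast
  then obtain F where F: "\<And>z y. blinfun_apply (F z) y \<le> q y" "\<And>z. blinfun_apply (F z) z = q z"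
    by metis
  have "q differentiable (at x)" if "x \<noteq> 0" for x
  proof -
    have "q x > 0"
      using lb[of x] a' that by (smt (verit) mult_pos_pos zero_less_norm_iff)
    then have "isCont F x"
      unfolding continuous_at_sequentially comp_def
    proof (intro allI impI)
      fix zs assume "zs \<longlonglongrightarrow> x"
      with \<open>q x > 0\<close> show "(\<lambda>i. F (zs i)) \<longlonglongrightarrow> F x"
        by (rule l2_infconv_supports_tendsto[OF p(1-3,5) N k q_def _ F(1) F(2) F(1) F(2)])
    qed
    from has_derivative_of_continuous_supports[OF F this] show ?thesis
      by (rule differentiableI)
  qed
  then show ?thesis
    unfolding frechet_smooth_at_origin_def q_def[symmetric] minkowski_functional_gauge[OF sq q0]
    using convex_body_gauge[OF sq a' lb p(4) ub] by blast
qed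

section \<open>Translations, Hausdorff distance and the approximation\<close>

lemma convex_body_translation:
  "convex_body B \<Longrightarrow> convex_body ((\<lambda>b. b + x) ` B)"
  using interior_translation[of x B]
  by (auto simp: convex_body_def add.commute[of _ x] closed_translation bounded_translation convex_translation)

lemma frechet_smooth_translation:
  assumes "frechet_smooth_at_origin C"
  shows "frechet_smooth ((\<lambda>c. c + x) ` C)"
  unfolding frechet_smooth_def
proof (intro conjI bexI)
  show "convex_body ((\<lambda>c. c + x) ` C)"
    using assms by (intro convex_body_translation) (simp add: frechet_smooth_at_origin_def)
  show "frechet_smooth_at_origin ((\<lambda>b. b - x) ` (\<lambda>c. c + x) ` C)"
    using assms by (simp add: image_image)
  show "x \<in> interior ((\<lambda>c. c + x) ` C)"
    using assms interior_translation[of x C] by (force simp: frechet_smooth_at_origin_def add.commute[of _ x])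
qed

text \<open>A near point \<open>t\<close> of \<open>s\<close> gives
  \<open>s = t + r *\<^sub>R u\<close> with \<open>u = (s - t) /\<^sub>R r\<close> in the unit ball,
  so \<open>r\<close> is admissible in the infimum.\<close>

lemma hausdorff_dist_le:
  assumes "r > 0" and "\<And>a. a \<in> A \<Longrightarrow> \<exists>b\<in>B. norm (a - b) \<le> r"
    and "\<And>b. b \<in> B \<Longrightarrow> \<exists>a\<in>A. norm (b - a) \<le> r"
  shows "hausdorff_dist A B \<le> r"
proof -
  have *: "S \<subseteq> closure {t + r *\<^sub>R u | t u. t \<in> T \<and> u \<in> cball 0 1}"
    if near: "\<And>s. s \<in> S \<Longrightarrow> \<exists>t\<in>T. norm (s - t) \<le> r" for S T :: "'a set"
  proof (rule order_trans[OF _ closure_subset], rule subsetI)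
    fix s assume "s \<in> S"
    then obtain t where t: "t \<in> T" "norm (s - t) \<le> r" using near by blast
    have "s = t + r *\<^sub>R ((s - t) /\<^sub>R r)" "(s - t) /\<^sub>R r \<in> cball 0 1"
      using \<open>r > 0\<close> t(2) by (simp_all add: inverse_eq_divide)
    with t(1) show "s \<in> {t + r *\<^sub>R u | t u. t \<in> T \<and> u \<in> cball 0 1}" by blast
  qed
  show ?thesis
    unfolding hausdorff_dist_def using assms *[of A B] *[of B A]
    by (intro cInf_lower bdd_belowI[of _ 0]) auto
qed

theorem theorem1p2:
  fixes B :: "'a::banach set" and \<epsilon> :: real
  assumes "\<exists>N :: 'a \<Rightarrow> real. equivalent_norm N \<and> locally_uniformly_convex (dual_norm N)"
    and "convex_body B"
    and "\<epsilon> > 0"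
  shows "\<exists>C. convex_body C \<and> frechet_smooth C \<and> hausdorff_dist B C < \<epsilon>"
proof -
  obtain N :: "'a \<Rightarrow> real" where N: "equivalent_norm N" "locally_uniformly_convex (dual_norm N)"
    using assms(1) by blast
  obtain c where c: "c > 0" "\<And>x. c * norm x \<le> N x"
    using N(1) by (auto simp: equivalent_norm_def)
  obtain x0 where x0: "x0 \<in> interior B"
    using assms(2) by (auto simp: convex_body_def)
  define B0 where "B0 = (\<lambda>b. b + - x0) ` B"
  have B0: "convex_body B0"
    unfolding B0_def using assms(2) by (rule convex_body_translation)
  have int: "0 \<in> interior B0"
    using x0 interior_translation[of "- x0" B] by (force simp: B0_def)
  define p where "p = minkowski_functional B0"
  have p: "sublinear p"
    unfolding p_def using B0 int by (rule sublinear_minkowski_functional)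
  obtain a b where ab: "a > 0" "\<And>x. a * norm x \<le> p x" "b > 0" "\<And>x. p x \<le> b * norm x"
    using minkowski_functional_bounds[OF B0 int] unfolding p_def by blast
  have B0_eq: "{x. p x \<le> 1} = B0"
    unfolding p_def using B0 int by (rule minkowski_functional_unit_ball)
  have p0: "p x \<ge> 0" for x
    using ab(1) ab(2)[of x] by (smt (verit) mult_nonneg_nonneg norm_ge_zero)
  \<comment> \<open>Points of \<open>B0\<close> have norm at most \<open>1 / a\<close>, so moving
    such a point \<open>z\<close> by \<open>\<theta> *\<^sub>R z\<close> costs at most
    \<open>\<epsilon> / 2\<close>.\<close>
  define \<theta> where "\<theta> = a * \<epsilon> / 2"
  have \<theta>: "\<theta> > 0" using ab(1) assms(3) by (simp add: \<theta>_def)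
  \<comment> \<open>Chosen so that \<open>p x \<le> b * norm x \<le> (b / c) * N x = \<theta> * (k *
    N x)\<close>.\<close>
  define k where "k = b / (c * \<theta>)"
  have k: "k > 0" using ab(3) c(1) \<theta> by (simp add: k_def)
  have p_le: "p x \<le> \<theta> * (k * N x)" for x
  proof -
    have "p x \<le> b * norm x" by (rule ab(4))
    also have "\<dots> \<le> b * (N x / c)"
      using ab(3) c by (intro mult_left_mono) (auto simp: field_simps)
    also have "\<dots> = \<theta> * (k * N x)"
      using c(1) \<theta> by (simp add: k_def)
    finally show ?thesis .
  qed
  define q where "q = l2_infconv p (\<lambda>x. k * N x)"
  have sm: "frechet_smooth_at_origin {x. q x \<le> 1}"
    unfolding q_def using p ab N k \<theta> p_le by (rule frechet_smooth_l2_infconv)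
  have norm_N: "is_norm N" using N by (simp add: equivalent_norm_def)
  have sn: "sublinear (\<lambda>x. k * N x)" "\<And>x. k * N x \<ge> 0"
    using k is_normD[OF norm_N] by (auto simp: sublinear_def distrib_left[symmetric])
  have q_le: "q x \<le> p x" for x
    unfolding q_def using sn(1) p0 by (rule l2_infconv_le_left)
  have p_le_q: "p x \<le> (1 + \<theta>) * q x" for x
    unfolding q_def using p p0 sn(2) less_imp_le[OF \<theta>] p_le by (rule le_l2_infconv_mult)
  define C where "C = (\<lambda>c. c + x0) ` {x. q x \<le> 1}"
  have "frechet_smooth C"
    unfolding C_def using sm by (rule frechet_smooth_translation)
  moreover from this have "convex_body C" by (simp add: frechet_smooth_def)
  moreover have "hausdorff_dist B C \<le> \<epsilon> / 2"
  proof (rule hausdorff_dist_le)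
    fix y assume "y \<in> B"
    then have "y - x0 \<in> {x. p x \<le> 1}"
      unfolding B0_eq by (auto simp: B0_def)
    \<comment> \<open>As \<open>q \<le> p\<close>, the body \<open>C\<close> contains
      \<open>B\<close>, and \<open>y\<close> is its own near point.\<close>
    then have "y \<in> C"
      using q_le[of "y - x0"] unfolding C_def by (intro image_eqI[of _ _ "y - x0"]) auto
    then show "\<exists>z\<in>C. norm (y - z) \<le> \<epsilon> / 2"
      using assms(3) by (intro bexI[of _ y]) auto
  next
    fix y assume "y \<in> C"
    then obtain x where x: "y = x + x0" "q x \<le> 1" by (auto simp: C_def)
    \<comment> \<open>Since \<open>p x \<le> 1 + \<theta>\<close>, shrinking by this factor lands in
      \<open>B0\<close>, at the displacement \<open>\<theta> *\<^sub>R z\<close>.\<close>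
    define z where "z = x /\<^sub>R (1 + \<theta>)"
    have xz: "x = (1 + \<theta>) *\<^sub>R z" using \<theta> by (simp add: z_def)
    have "p x \<le> (1 + \<theta>) * 1"
      by (rule order_trans[OF p_le_q mult_left_mono[OF x(2)]]) (use \<theta> in simp)
    then have pz: "p z \<le> 1"
      using \<theta> sublinear_scale[OF p, of "1 + \<theta>" z] by (simp add: xz)
    then have "z \<in> B0" using B0_eq by blast
    then have "z + x0 \<in> B" by (auto simp: B0_def)
    moreover have "norm (y - (z + x0)) \<le> \<epsilon> / 2"
    proof -
      have "y - (z + x0) = \<theta> *\<^sub>R z" by (simp add: x(1) xz algebra_simps)
      then have "norm (y - (z + x0)) = \<epsilon> / 2 * (a * norm z)"
        using \<theta> by (simp add: \<theta>_def)
      also have "\<dots> \<le> \<epsilon> / 2 * 1"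
        using assms(3) ab(2)[of z] pz by (intro mult_left_mono) auto
      finally show ?thesis by simp
    qed
    ultimately show "\<exists>z\<in>B. norm (y - z) \<le> \<epsilon> / 2" by blast
  qed (use assms(3) in simp)
  ultimately show ?thesis
    using assms(3) by (intro exI[of _ C]) auto
qed

end
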